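(* Let ${\cal P}=\{P_1,\dots,P_N\}$ be a set of players and let $\Gamma=\{\alpha_1,\dots,\alpha_r\}$ be an access structure on ${\cal P}$, i.e. a family of nonempty subsets $\alpha_j\subseteq{\cal P}$ (the authorized sets). Let $\lambda$ be the minimum number of classes in a partial link classification of $\Gamma$. Then an assisted quantum secret sharing (AQSS) scheme realizing $\Gamma$ exists if and only if $\Gamma$ is monotone. In particular, no pairwise-intersection condition $\alpha_j\cap\alpha_k\neq\emptyset$ is required. Moreover, such a scheme can be constructed using at most $\lambda-1$ resident shares.
   Context: Quantum secret sharing (QSS) for an access structure $\Gamma$: a dealer encodes an arbitrary unknown quantum state $|S\rangle$ (the secret) into $n$ quantum systems (shares), which are distributed among the players. The requirements are: - every set of players containing an authorized set can recover $|S\rangle$ exactly from their shares; - every set of players containing no authorized set obtains no information about $|S\rangle$ from their shares. $\Gamma$ is called monotone if every set of players containing an authorized set is itself authorized. Assisted QSS (AQSS): a generalization of QSS in which the dealer keeps $m<n$ of the shares (called resident shares) and distributes the remaining shares (player shares) among the players. The requirements become: - for every set of players containing an authorized set, its player shares together with the resident shares allow exact reconstruction of $|S\rangle$; - for every set of players containing no authorized set, its player shares together with the resident shares carry no information about $|S\rangle$. Conventional QSS is the case $m=0$; by the no-cloning theorem it requires $\alpha_j\cap\alpha_k\neq\emptyset$ for all $j,k$. Partial link classification of $\Gamma$: a partition of the family $\Gamma$ into classes satisfying two conditions: (a) any two authorized sets in the same class have nonempty intersection; (b) for any two distinct classes there exist $\alpha_j$ in one and $\alpha_k$ in the other with $\alpha_j\cap\alpha_k=\emptyset$.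 Equivalently, consider the graph whose vertices are the $\alpha_j$, with an edge between $\alpha_j$ and $\alpha_k$ whenever $\alpha_j\cap\alpha_k\neq\emptyset$. Then $\lambda$, the minimum number of classes in a partial link classification, equals the minimum number of cliques into which the vertex set of this graph can be partitioned.
   Formalization: "Realizing Γ" additionally requires that exactly the members of Γ can recover the secret; without this, the "only if" fails (P={P1,P2}, Γ={{P1}}, give the secret to P1). The secret has dimension at least 2 and Γ is nonempty. *)

theory Defs
  imports Complex_Main "HOL-Library.FuncSet" "HOL-Library.Disjoint_Sets"
begin

text \<open>A quantum system is given by a finite set I of basis labels; an operator on it
is a matrix indexed by I (entries outside I are irrelevant / zero).\<close>

definition is_density :: "'i set \<Rightarrow> ('i \<Rightarrow> 'i \<Rightarrow> complex) \<Rightarrow> bool" where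
  "is_density I \<rho> \<longleftrightarrow>
     (\<forall>x y. (x \<notin> I \<or> y \<notin> I) \<longrightarrow> \<rho> x y = 0) \<and>
     (\<Sum>x\<in>I. \<rho> x x) = 1 \<and>
     (\<forall>v :: 'i \<Rightarrow> complex.
        Im (\<Sum>x\<in>I. \<Sum>y\<in>I. cnj (v x) * \<rho> x y * v y) = 0 \<and>
        Re (\<Sum>x\<in>I. \<Sum>y\<in>I. cnj (v x) * \<rho> x y * v y) \<ge> 0)"

definition kraus_channel :: "'i set \<Rightarrow> 'j set \<Rightarrow> ('j \<Rightarrow> 'i \<Rightarrow> complex) list \<Rightarrow> bool" where
  "kraus_channel I J Ks \<longleftrightarrow>
     (\<forall>K\<in>set Ks. \<forall>y x. (y \<notin> J \<or> x \<notin> I) \<longrightarrow> K y x = 0) \<and>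
     (\<forall>x\<in>I. \<forall>x'\<in>I. (\<Sum>K\<leftarrow>Ks. \<Sum>y\<in>J. cnj (K y x) * K y x') = (if x = x' then 1 else 0))"

definition apply_channel :: "'i set \<Rightarrow> ('j \<Rightarrow> 'i \<Rightarrow> complex) list \<Rightarrow>
    ('i \<Rightarrow> 'i \<Rightarrow> complex) \<Rightarrow> ('j \<Rightarrow> 'j \<Rightarrow> complex)" where
  "apply_channel I Ks \<rho> = (\<lambda>y y'. \<Sum>K\<leftarrow>Ks. \<Sum>x\<in>I. \<Sum>x'\<in>I. K y x * \<rho> x x' * cnj (K y' x'))"

text \<open>Share i (i < n) has dimension d i; basis labels of the subsystem consisting of the
shares in S are the tuples in PiE S (\<lambda>i. {..<d i}).\<close>

definition sub_basis :: "(nat \<Rightarrow> nat) \<Rightarrow> nat set \<Rightarrow> (nat \<Rightarrow> nat) set" where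
  "sub_basis d S = (\<Pi>\<^sub>E i\<in>S. {..<d i})"

definition merge_idx :: "nat set \<Rightarrow> (nat \<Rightarrow> nat) \<Rightarrow> (nat \<Rightarrow> nat) \<Rightarrow> (nat \<Rightarrow> nat)" where
  "merge_idx S a z = (\<lambda>i. if i \<in> S then a i else z i)"

definition ptrace :: "nat \<Rightarrow> (nat \<Rightarrow> nat) \<Rightarrow> nat set \<Rightarrow>
    ((nat \<Rightarrow> nat) \<Rightarrow> (nat \<Rightarrow> nat) \<Rightarrow> complex) \<Rightarrow> ((nat \<Rightarrow> nat) \<Rightarrow> (nat \<Rightarrow> nat) \<Rightarrow> complex)" where
  "ptrace n d S \<rho> = (\<lambda>a b. if a \<in> sub_basis d S \<and> b \<in> sub_basis d S
      then (\<Sum>z\<in>sub_basis d ({..<n} - S). \<rho> (merge_idx S a z) (merge_idx S b z)) else 0)"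

text \<open>Secret space: dimension D, basis {..<D}. Encoding: channel Enc from the secret
to all n shares.\<close>

definition recovers :: "nat \<Rightarrow> nat \<Rightarrow> (nat \<Rightarrow> nat) \<Rightarrow> ((nat \<Rightarrow> nat) \<Rightarrow> nat \<Rightarrow> complex) list
    \<Rightarrow> nat set \<Rightarrow> bool" where
  "recovers D n d Enc S \<longleftrightarrow>
     (\<exists>Rs :: (nat \<Rightarrow> (nat \<Rightarrow> nat) \<Rightarrow> complex) list.
        kraus_channel (sub_basis d S) {..<D} Rs \<and>
        (\<forall>\<rho>. is_density {..<D} \<rho> \<longrightarrow>
           apply_channel (sub_basis d S) Rs (ptrace n d S (apply_channel {..<D} Enc \<rho>)) = \<rho>))"

definition no_info :: "nat \<Rightarrow> nat \<Rightarrow> (nat \<Rightarrow> nat) \<Rightarrow> ((nat \<Rightarrow> nat) \<Rightarrow> nat \<Rightarrow> complex) list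
    \<Rightarrow> nat set \<Rightarrow> bool" where
  "no_info D n d Enc S \<longleftrightarrow>
     (\<forall>\<rho> \<sigma>. is_density {..<D} \<rho> \<longrightarrow> is_density {..<D} \<sigma> \<longrightarrow>
        ptrace n d S (apply_channel {..<D} Enc \<rho>) = ptrace n d S (apply_channel {..<D} Enc \<sigma>))"

definition shares_of :: "nat \<Rightarrow> nat set \<Rightarrow> (nat \<Rightarrow> 'p) \<Rightarrow> 'p set \<Rightarrow> nat set" where
  "shares_of n Res own A = Res \<union> {i \<in> {..<n} - Res. own i \<in> A}"

text \<open>An AQSS scheme for the access structure \<Gamma> on players P, with secret dimension D,
n shares of dimensions d, resident shares Res (m = card Res < n), player shares
i \<notin> Res given to player own i, and encoding channel Enc.  The authorized sets are
exactly the members of \<Gamma>.\<close>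
definition AQSS :: "'p set \<Rightarrow> 'p set set \<Rightarrow> nat \<Rightarrow> nat \<Rightarrow> (nat \<Rightarrow> nat) \<Rightarrow> nat set
    \<Rightarrow> (nat \<Rightarrow> 'p) \<Rightarrow> ((nat \<Rightarrow> nat) \<Rightarrow> nat \<Rightarrow> complex) list \<Rightarrow> bool" where
  "AQSS P \<Gamma> D n d Res own Enc \<longleftrightarrow>
     Res \<subseteq> {..<n} \<and> card Res < n \<and>
     (\<forall>i<n. 1 \<le> d i) \<and>
     (\<forall>i\<in>{..<n} - Res. own i \<in> P) \<and>
     kraus_channel {..<D} (sub_basis d {..<n}) Enc \<and>
     (\<forall>A. A \<subseteq> P \<longrightarrow> (\<exists>\<alpha>\<in>\<Gamma>. \<alpha> \<subseteq> A) \<longrightarrow> recovers D n d Enc (shares_of n Res own A)) \<and>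
     (\<forall>A. A \<subseteq> P \<longrightarrow> \<not> (\<exists>\<alpha>\<in>\<Gamma>. \<alpha> \<subseteq> A) \<longrightarrow> no_info D n d Enc (shares_of n Res own A)) \<and>
     (\<forall>A. A \<subseteq> P \<longrightarrow> (A \<in> \<Gamma> \<longleftrightarrow> recovers D n d Enc (shares_of n Res own A)))"

definition monotone_access :: "'p set \<Rightarrow> 'p set set \<Rightarrow> bool" where
  "monotone_access P \<Gamma> \<longleftrightarrow> (\<forall>\<alpha>\<in>\<Gamma>. \<forall>B. \<alpha> \<subseteq> B \<and> B \<subseteq> P \<longrightarrow> B \<in> \<Gamma>)"

definition partial_link_classification :: "'p set set \<Rightarrow> 'p set set set \<Rightarrow> bool" where
  "partial_link_classification \<Gamma> C \<longleftrightarrow>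
     partition_on \<Gamma> C \<and>
     (\<forall>c\<in>C. \<forall>\<alpha>\<in>c. \<forall>\<beta>\<in>c. \<alpha> \<inter> \<beta> \<noteq> {}) \<and>
     (\<forall>c1\<in>C. \<forall>c2\<in>C. c1 \<noteq> c2 \<longrightarrow> (\<exists>\<alpha>\<in>c1. \<exists>\<beta>\<in>c2. \<alpha> \<inter> \<beta> = {}))"

definition plc_min :: "'p set set \<Rightarrow> nat" where
  "plc_min \<Gamma> = (LEAST k. \<exists>C. partial_link_classification \<Gamma> C \<and> finite C \<and> card C = k)"

end

theory Submission
  imports Defs "HOL-Number_Theory.Cong"
begin

text \<open>Encode the basis state \<open>s\<close> as the uniform superposition of all vectors over \<open>\<int>/D\<close> whose
  coordinates sum to \<open>s\<close> along every set of a family of ``checks'', and discard one coordinate, the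
  environment. A set \<open>S\<close> of coordinates containing a check reads off \<open>s\<close>; if moreover \<open>S\<close> contains a set \<open>V\<close>
  meeting each check exactly once, then adding \<open>- s\<close> along \<open>V\<close> disentangles \<open>s\<close> from all the rest, so \<open>S\<close>
  recovers the secret. Dually, if the complement of \<open>S\<close> contains a check, it destroys the coherences
  between different \<open>s\<close>, and if it also contains such a \<open>V\<close>, the state on \<open>S\<close> does not depend on \<open>s\<close>.

  For a monotone \<open>\<Gamma>\<close> take for every \<open>X \<in> \<Gamma>\<close> a check with one private coordinate for each player in \<open>X\<close>,
  and for every \<open>X \<notin> \<Gamma>\<close> a check with one private coordinate for each player outside \<open>X\<close> and the
  environment; the latter makes the complement of an unauthorized set contain a check. An authorized set
  meets all checks of the second kind by monotonicity. It meets those of the first kind if \<open>\<Gamma>\<close> is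
  pairwise intersecting; otherwise \<open>\<lambda> \<ge> 2\<close>, and a single resident coordinate added to all of them suffices.\<close>

section \<open>Index sums over product bases\<close>

lemma sum_sub_basis_insert:
  assumes "i \<notin> S"
  shows "(\<Sum>z\<in>sub_basis d S. \<Sum>e<d i. f (z(i := e))) = (\<Sum>z\<in>sub_basis d (insert i S). f z)"
proof -
  have "bij_betw (\<lambda>(z, e). z(i := e)) (sub_basis d S \<times> {..<d i}) (sub_basis d (insert i S))"
    unfolding sub_basis_def
  proof (rule bij_betw_byWitness[where f' = "\<lambda>z. (z(i := undefined), z i)"])
    show "\<forall>p\<in>PiE S (\<lambda>i. {..<d i}) \<times> {..<d i}.
        (((case p of (z, e) \<Rightarrow> z(i := e))(i := undefined)), (case p of (z, e) \<Rightarrow> z(i := e)) i) = p"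
      using assms by (auto simp: PiE_def extensional_def fun_eq_iff)
    show "\<forall>z\<in>PiE (insert i S) (\<lambda>i. {..<d i}). (case (z(i := undefined), z i) of (z, e) \<Rightarrow> z(i := e)) = z"
      by auto
    show "(\<lambda>(z, e). z(i := e)) ` (PiE S (\<lambda>i. {..<d i}) \<times> {..<d i}) \<subseteq> PiE (insert i S) (\<lambda>i. {..<d i})"
      by (auto simp: PiE_iff extensional_def split: if_splits)
    show "(\<lambda>z. (z(i := undefined), z i)) ` PiE (insert i S) (\<lambda>i. {..<d i}) \<subseteq> PiE S (\<lambda>i. {..<d i}) \<times> {..<d i}"
      using assms by (fastforce simp: PiE_iff extensional_def)
  qed
  from sum.reindex_bij_betw[OF this, of f, symmetric]
  show ?thesis by (simp add: sum.cartesian_product split_def)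
qed

lemma finite_sub_basis: "finite S \<Longrightarrow> finite (sub_basis d S)"
  unfolding sub_basis_def by (rule finite_PiE) auto

lemma sum_sub_basis_merge:
  assumes "S \<subseteq> T"
  shows "(\<Sum>a\<in>sub_basis d S. \<Sum>z\<in>sub_basis d (T - S). f (merge_idx S a z)) = (\<Sum>x\<in>sub_basis d T. f x)"
proof -
  have "bij_betw (\<lambda>(a, z). merge_idx S a z) (sub_basis d S \<times> sub_basis d (T - S)) (sub_basis d T)"
  proof (rule bij_betw_byWitness[where f' = "\<lambda>x. (restrict x S, restrict x (T - S))"])
    show "\<forall>p\<in>sub_basis d S \<times> sub_basis d (T - S).
       (restrict (case p of (a, z) \<Rightarrow> merge_idx S a z) S,
        restrict (case p of (a, z) \<Rightarrow> merge_idx S a z) (T - S)) = p"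
      unfolding sub_basis_def merge_idx_def
      by (auto simp: fun_eq_iff restrict_def PiE_iff extensional_def)
    show "\<forall>x\<in>sub_basis d T. (case (restrict x S, restrict x (T - S)) of (a, z) \<Rightarrow> merge_idx S a z) = x"
      using assms unfolding sub_basis_def merge_idx_def
      by (auto simp: fun_eq_iff restrict_def PiE_iff extensional_def)
    show "(\<lambda>(a, z). merge_idx S a z) ` (sub_basis d S \<times> sub_basis d (T - S)) \<subseteq> sub_basis d T"
      using assms unfolding sub_basis_def merge_idx_def
      by (auto simp: PiE_iff extensional_def)
    show "(\<lambda>x. (restrict x S, restrict x (T - S))) ` sub_basis d T \<subseteq> sub_basis d S \<times> sub_basis d (T - S)"
      using assms unfolding sub_basis_def
      by (auto simp: PiE_iff extensional_def)
  qed
  from sum.reindex_bij_betw[OF this, of f, symmetric]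
  show ?thesis by (simp add: sum.cartesian_product split_def)
qed

lemma merge_idx_in_sub_basis:
  assumes "S \<subseteq> T" "a \<in> sub_basis d S" "z \<in> sub_basis d (T - S)"
  shows "merge_idx S a z \<in> sub_basis d T"
  using assms unfolding sub_basis_def merge_idx_def by (auto simp: PiE_iff extensional_def)

section \<open>Translations modulo \<open>D\<close> along a set of coordinates\<close>

definition shift :: "nat \<Rightarrow> nat set \<Rightarrow> nat \<Rightarrow> (nat \<Rightarrow> nat) \<Rightarrow> nat \<Rightarrow> nat" where
  "shift D V s x = (\<lambda>i. if i \<in> V then (x i + s) mod D else x i)"

text \<open>Only one coordinate of \<open>c\<close> is moved, so \<open>s\<close> enters the sum
  once; reducing that coordinate modulo \<open>D\<close> does not affect the residue of the
  sum.\<close>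

lemma sum_shift_mod:
  assumes "finite c" "card (c \<inter> V) = 1"
  shows "(\<Sum>i\<in>c. shift D V s x i) mod D = ((\<Sum>i\<in>c. x i) + s) mod D"
proof -
  obtain j where j: "c \<inter> V = {j}" using assms by (auto simp: card_1_singleton_iff)
  have jc: "j \<in> c" "j \<in> V" using j by auto
  have "(\<Sum>i\<in>c. shift D V s x i) = shift D V s x j + (\<Sum>i\<in>c - {j}. shift D V s x i)"
    using assms(1) jc by (simp add: sum.remove)
  also have "(\<Sum>i\<in>c - {j}. shift D V s x i) = (\<Sum>i\<in>c - {j}. x i)"
    using j by (intro sum.cong) (auto simp: shift_def)
  finally have "(\<Sum>i\<in>c. shift D V s x i) mod D = (x j + s + (\<Sum>i\<in>c - {j}. x i)) mod D"
    using jc by (simp add: shift_def mod_simps)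
  moreover have "(\<Sum>i\<in>c. x i) = x j + (\<Sum>i\<in>c - {j}. x i)"
    using assms(1) jc by (simp add: sum.remove)
  ultimately show ?thesis by (simp add: ac_simps)
qed

text \<open>Injectivity is cancellation modulo \<open>D\<close> in each coordinate; surjectivity
  follows because the basis is finite.\<close>

lemma bij_betw_shift:
  assumes "0 < D" "V \<subseteq> S" "finite S"
  shows "bij_betw (shift D V s) (sub_basis (\<lambda>_. D) S) (sub_basis (\<lambda>_. D) S)"
proof -
  have into: "shift D V s ` sub_basis (\<lambda>_. D) S \<subseteq> sub_basis (\<lambda>_. D) S"
    using assms by (auto simp: shift_def sub_basis_def PiE_iff extensional_def)
  have "inj_on (shift D V s) (sub_basis (\<lambda>_. D) S)"
  proof (rule inj_onI)
    fix x y assume xy: "x \<in> sub_basis (\<lambda>_. D) S" "y \<in> sub_basis (\<lambda>_. D) S"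
      and eq: "shift D V s x = shift D V s y"
    show "x = y"
    proof
      fix i
      show "x i = y i"
      proof (cases "i \<in> V")
        case True
        then have "x i < D" "y i < D" using xy assms by (auto simp: sub_basis_def PiE_iff)
        moreover have "[x i + s = y i + s] (mod D)"
          using fun_cong[OF eq, of i] True by (simp add: shift_def cong_def)
        ultimately show ?thesis
          by (simp add: cong_add_rcancel_nat cong_less_modulus_unique_nat)
      next
        case False
        then show ?thesis using fun_cong[OF eq, of i] by (simp add: shift_def)
      qed
    qed
  qed
  then show ?thesis
    using into endo_inj_surj[OF finite_sub_basis[OF assms(3)] into] by (simp add: bij_betw_def)
qed

lemma shift_merge_left: "V \<subseteq> S \<Longrightarrow> shift D V s (merge_idx S a z) = merge_idx S (shift D V s a) z"
  by (auto simp: shift_def merge_idx_def fun_eq_iff)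

lemma shift_merge_right: "V \<inter> S = {} \<Longrightarrow> shift D V s (merge_idx S a z) = merge_idx S a (shift D V s z)"
  by (auto simp: shift_def merge_idx_def fun_eq_iff)

section \<open>The code defined by a family of checks: encoding, secrecy, recovery\<close>

text \<open>The shares are the coordinates below \<open>n\<close>; coordinate \<open>n\<close> is the environment, whose values
  index the Kraus operators of the encoder.\<close>

locale check_code =
  fixes D n :: nat and C :: "nat set set"
  assumes D_pos: "0 < D"
    and checks_nonempty: "C \<noteq> {}"
    and checks_subset: "c \<in> C \<Longrightarrow> c \<subseteq> {..n}"
    and checks_hit: "\<exists>V\<subseteq>{..n}. \<forall>c\<in>C. card (c \<inter> V) = 1"
begin

abbreviation B :: "nat set \<Rightarrow> (nat \<Rightarrow> nat) set" where
  "B S \<equiv> sub_basis (\<lambda>_. D) S"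

definition codeword :: "nat \<Rightarrow> (nat \<Rightarrow> nat) \<Rightarrow> bool" where
  "codeword s x \<longleftrightarrow> (\<forall>c\<in>C. (\<Sum>i\<in>c. x i) mod D = s)"

definition code_size :: nat where
  "code_size = card {x \<in> B {..n}. codeword 0 x}"

text \<open>One Kraus operator per environment value \<open>e\<close>: together they trace out
  coordinate \<open>n\<close> of the normalized superposition of all codewords of
  \<open>s\<close>.\<close>

definition encoder :: "((nat \<Rightarrow> nat) \<Rightarrow> nat \<Rightarrow> complex) list" where
  "encoder = map (\<lambda>e y s. if y \<in> B {..<n} \<and> s < D \<and> codeword s (y(n := e))
     then complex_of_real (1 / sqrt code_size) else 0) [0..<D]"

lemma codeword_unique: "codeword s x \<Longrightarrow> codeword t x \<Longrightarrow> s = t"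
  using checks_nonempty by (auto simp: codeword_def)

lemma codeword_shift:
  assumes "s < D" "\<And>c. c \<in> C \<Longrightarrow> card (c \<inter> V) = 1"
  shows "codeword s (shift D V s x) \<longleftrightarrow> codeword 0 x"
proof -
  have "(\<Sum>i\<in>c. shift D V s x i) mod D = s \<longleftrightarrow> (\<Sum>i\<in>c. x i) mod D = 0" if "c \<in> C" for c
  proof -
    have "(\<Sum>i\<in>c. shift D V s x i) mod D = ((\<Sum>i\<in>c. x i) + s) mod D"
      using assms(2)[OF that] finite_subset[OF checks_subset[OF that]] by (intro sum_shift_mod) auto
    moreover have "((\<Sum>i\<in>c. x i) + s) mod D = s \<longleftrightarrow> (\<Sum>i\<in>c. x i) mod D = 0"
      using assms(1) cong_add_rcancel_0_nat[of "\<Sum>i\<in>c. x i" s D] by (simp add: cong_def)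
    ultimately show ?thesis by simp
  qed
  then show ?thesis by (simp add: codeword_def)
qed

text \<open>The shift along \<open>V\<close> carries the codewords of 0 onto those of
  \<open>s\<close>, so a single normalization serves every secret.\<close>

lemma sum_codeword:
  assumes "s < D"
  shows "(\<Sum>x\<in>B {..n}. of_bool (codeword s x)) = (of_nat code_size :: complex)"
proof -
  obtain V where V: "V \<subseteq> {..n}" "\<And>c. c \<in> C \<Longrightarrow> card (c \<inter> V) = 1"
    using checks_hit by blast
  have "(\<Sum>x\<in>B {..n}. of_bool (codeword s x) :: complex)
      = (\<Sum>x\<in>B {..n}. of_bool (codeword s (shift D V s x)))"
    by (rule sum.reindex_bij_betw[OF bij_betw_shift[OF D_pos V(1) finite_atMost], symmetric])
  also have "\<dots> = (\<Sum>x\<in>B {..n}. of_bool (codeword 0 x))"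
    using codeword_shift[OF assms V(2)] by simp
  also have "\<dots> = of_nat code_size"
    by (simp add: code_size_def finite_sub_basis Int_def)
  finally show ?thesis .
qed

lemma code_size_pos: "0 < code_size"
proof -
  have "(\<lambda>i\<in>{..n}. 0) \<in> B {..n}" using D_pos by (auto simp: sub_basis_def)
  moreover have "codeword 0 (\<lambda>i\<in>{..n}. 0)"
    unfolding codeword_def
  proof
    fix c assume "c \<in> C"
    then have "(\<Sum>i\<in>c. (\<lambda>i\<in>{..n}. 0) i) = (0::nat)"
      using checks_subset by (intro sum.neutral) auto
    then show "(\<Sum>i\<in>c. (\<lambda>i\<in>{..n}. 0) i) mod D = 0" by (simp only: mod_0)
  qed
  ultimately show ?thesis
    unfolding code_size_def using finite_sub_basis[of "{..n}"] by (auto simp: card_gt_0_iff)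
qed

lemma sqrt_code_size: "complex_of_real (sqrt code_size) * complex_of_real (sqrt code_size) = of_nat code_size"
  by (simp flip: of_real_mult)

text \<open>Trace preservation is orthonormality of the code states: equal norms by
  \<open>sum_codeword\<close>, orthogonality because no vector is a codeword of two secrets.\<close>

lemma kraus_channel_encoder: "kraus_channel {..<D} (B {..<n}) encoder"
  unfolding kraus_channel_def
proof (intro conjI ballI)
  fix K assume "K \<in> set encoder"
  then show "\<forall>y x. (y \<notin> B {..<n} \<or> x \<notin> {..<D}) \<longrightarrow> K y x = 0"
    by (auto simp: encoder_def)
next
  fix s t assume st: "s \<in> {..<D}" "t \<in> {..<D}"
  have "(\<Sum>K\<leftarrow>encoder. \<Sum>y\<in>B {..<n}. cnj (K y s) * K y t)
      = (\<Sum>e<D. \<Sum>y\<in>B {..<n}. of_bool (codeword s (y(n := e)) \<and> codeword t (y(n := e))) / of_nat code_size)"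
    using st by (auto simp: encoder_def o_def interv_sum_list_conv_sum_set_nat atLeast0LessThan
        sqrt_code_size intro!: sum.cong)
  also have "\<dots> = (\<Sum>x\<in>B {..n}. of_bool (codeword s x \<and> codeword t x) / of_nat code_size)"
    using sum_sub_basis_insert[of n "{..<n}"
        "\<lambda>x. of_bool (codeword s x \<and> codeword t x) / of_nat code_size :: complex" "\<lambda>_. D"]
    by (subst sum.swap) (simp flip: lessThan_Suc add: lessThan_Suc_atMost)
  also have "\<dots> = (if s = t then 1 else 0)"
  proof (cases "s = t")
    case True
    then show ?thesis
      using sum_codeword[of s] st code_size_pos by (simp flip: sum_divide_distrib)
  next
    case False
    then have "\<not> (codeword s x \<and> codeword t x)" for x using codeword_unique by blast
    then show ?thesis using False by (simp only: of_bool_eq) simp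
  qed
  finally show "(\<Sum>K\<leftarrow>encoder. \<Sum>y\<in>B {..<n}. cnj (K y s) * K y t) = (if s = t then 1 else 0)" .
qed

lemma apply_encoder:
  assumes "y \<in> B {..<n}" "y' \<in> B {..<n}"
  shows "apply_channel {..<D} encoder \<rho> y y' = (\<Sum>e<D. \<Sum>s<D. \<Sum>t<D.
      of_bool (codeword s (y(n := e)) \<and> codeword t (y'(n := e))) * \<rho> s t / of_nat code_size)"
  using assms by (auto simp: apply_channel_def encoder_def o_def interv_sum_list_conv_sum_set_nat
      atLeast0LessThan sqrt_code_size intro!: sum.cong)

text \<open>Summing over the Kraus index traces out the environment, which thereby joins the missing
  shares: hence \<open>{..n} - S\<close> rather than \<open>{..<n} - S\<close>.\<close>

lemma ptrace_encoder:
  assumes S: "S \<subseteq> {..<n}" and ab: "a \<in> B S" "b \<in> B S"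
  shows "ptrace n (\<lambda>_. D) S (apply_channel {..<D} encoder \<rho>) a b =
    (\<Sum>z\<in>B ({..n} - S). \<Sum>s<D. \<Sum>t<D.
      of_bool (codeword s (merge_idx S a z) \<and> codeword t (merge_idx S b z)) * \<rho> s t / of_nat code_size)"
    (is "_ = (\<Sum>z\<in>_. ?f z)")
proof -
  have upd: "(merge_idx S a z)(n := e) = merge_idx S a (z(n := e))" for a z e
    using S by (auto simp: merge_idx_def fun_eq_iff)
  have "insert n ({..<n} - S) = {..n} - S" using S by auto
  then have "(\<Sum>z\<in>B ({..n} - S). ?f z) = (\<Sum>z\<in>B ({..<n} - S). \<Sum>e<D. ?f (z(n := e)))"
    using sum_sub_basis_insert[of n "{..<n} - S" ?f "\<lambda>_. D"] by simp
  then show ?thesis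
    using ab merge_idx_in_sub_basis[OF S] by (simp add: ptrace_def apply_encoder upd)
qed

lemma no_info_encoder:
  assumes S: "S \<subseteq> {..<n}" and c: "c \<in> C" "c \<inter> S = {}"
    and V: "V \<subseteq> {..n} - S" "\<And>c. c \<in> C \<Longrightarrow> card (c \<inter> V) = 1"
  shows "no_info D n (\<lambda>_. D) encoder S"
  unfolding no_info_def
proof (intro allI impI)
  \<comment> \<open>The reduced state of basis state 0, which turns out to be that of every
    input.\<close>
  define q where "q a b = (\<Sum>z\<in>B ({..n} - S).
      of_bool (codeword 0 (merge_idx S a z) \<and> codeword 0 (merge_idx S b z)) / of_nat code_size :: complex)"
    for a b
  have reduced: "ptrace n (\<lambda>_. D) S (apply_channel {..<D} encoder \<rho>) a b = q a b"
    if \<rho>: "is_density {..<D} \<rho>" and ab: "a \<in> B S" "b \<in> B S" for \<rho> a b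
  proof -
    have sum_c: "(\<Sum>i\<in>c. merge_idx S a z i) = (\<Sum>i\<in>c. merge_idx S b z i)" for z
      using c by (intro sum.cong) (auto simp: merge_idx_def)
    \<comment> \<open>Both vectors agree outside \<open>S\<close>, hence along \<open>c\<close>, and
      so encode the same secret: coherences between different secrets vanish.\<close>
    have diag: "s = t" if "codeword s (merge_idx S a z)" "codeword t (merge_idx S b z)" for s t z
      using that c(1) sum_c[of z] by (auto simp: codeword_def)
    have "ptrace n (\<lambda>_. D) S (apply_channel {..<D} encoder \<rho>) a b =
      (\<Sum>z\<in>B ({..n} - S). \<Sum>s<D. \<Sum>t<D.
        of_bool (codeword s (merge_idx S a z) \<and> codeword t (merge_idx S b z)) * \<rho> s t / of_nat code_size)"
      using S ab by (rule ptrace_encoder)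
    also have "\<dots> = (\<Sum>z\<in>B ({..n} - S). \<Sum>s<D. \<Sum>t<D. if s = t then
        of_bool (codeword s (merge_idx S a z) \<and> codeword s (merge_idx S b z)) * \<rho> s s / of_nat code_size else 0)"
      using diag by (intro sum.cong) auto
    also have "\<dots> = (\<Sum>s<D. \<rho> s s * (\<Sum>z\<in>B ({..n} - S).
        of_bool (codeword s (merge_idx S a z) \<and> codeword s (merge_idx S b z)) / of_nat code_size))"
      by (subst sum.swap) (simp add: sum_distrib_left mult.commute)
    \<comment> \<open>Shifting the traced-out part along \<open>V\<close> turns the secret 0 into
      \<open>s\<close> and leaves \<open>a\<close> and \<open>b\<close> alone, so every diagonal
      term equals the one for 0.\<close>
    also have "\<dots> = (\<Sum>s<D. \<rho> s s * q a b)"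
    proof (intro sum.cong refl arg_cong2[where f = "(*)"])
      fix s assume "s \<in> {..<D}"
      then have s: "s < D" by simp
      have disj: "V \<inter> S = {}" using V by auto
      have "(\<Sum>z\<in>B ({..n} - S). of_bool (codeword s (merge_idx S a z) \<and> codeword s (merge_idx S b z))
            / of_nat code_size :: complex)
        = (\<Sum>z\<in>B ({..n} - S). of_bool (codeword s (merge_idx S a (shift D V s z))
            \<and> codeword s (merge_idx S b (shift D V s z))) / of_nat code_size)"
        by (rule sum.reindex_bij_betw[OF bij_betw_shift[OF D_pos V(1)], symmetric]) simp
      also have "\<dots> = q a b"
        by (simp add: q_def codeword_shift s V(2) flip: shift_merge_right[OF disj])
      finally show "(\<Sum>z\<in>B ({..n} - S). of_bool (codeword s (merge_idx S a z) \<and> codeword s (merge_idx S b z))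
            / of_nat code_size) = q a b" .
    qed
    also have "\<dots> = q a b"
      using \<rho> by (simp add: is_density_def flip: sum_distrib_right)
    finally show ?thesis .
  qed
  fix \<rho> \<sigma> assume "is_density {..<D} \<rho>" "is_density {..<D} \<sigma>"
  then show "ptrace n (\<lambda>_. D) S (apply_channel {..<D} encoder \<rho>)
      = ptrace n (\<lambda>_. D) S (apply_channel {..<D} encoder \<sigma>)"
    \<comment> \<open>Entries with labels outside \<open>B S\<close> are 0 by definition of
      \<open>ptrace\<close>.\<close>
    using reduced by (intro ext) (metis ptrace_def)
qed

lemma recovers_encoder:
  assumes S: "S \<subseteq> {..<n}" and c: "c \<in> C" "c \<subseteq> S"
    and V: "V \<subseteq> S" "\<And>c. c \<in> C \<Longrightarrow> card (c \<inter> V) = 1"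
  shows "recovers D n (\<lambda>_. D) encoder S"
proof -
  have finS: "finite S" using S finite_subset by blast
  obtain ws where ws: "set ws = B S" "distinct ws"
    using finite_distinct_list[OF finite_sub_basis[OF finS]] by blast
  define dec where "dec a = (\<Sum>i\<in>c. a i) mod D" for a :: "nat \<Rightarrow> nat"
  \<comment> \<open>Together the \<open>R w\<close> send a basis vector \<open>a\<close> to the pair
    of \<open>s = dec a\<close> and the vector \<open>w\<close> obtained by undoing the shift by
    \<open>s\<close>, and then discard \<open>w\<close>. Coherences survive because \<open>w\<close>
    keeps no trace of \<open>s\<close>.\<close>
  define R :: "(nat \<Rightarrow> nat) \<Rightarrow> nat \<Rightarrow> (nat \<Rightarrow> nat) \<Rightarrow> complex" where
    "R w s a = of_bool (a \<in> B S \<and> s < D \<and> dec a = s \<and> a = shift D V s w)" for w s a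
  have bij: "bij_betw (shift D V s) (B S) (B S)" for s
    using bij_betw_shift[OF D_pos V(1) finS] .
  have sum_R: "(\<Sum>K\<leftarrow>map R ws. f K) = (\<Sum>w\<in>B S. f (R w))" for f :: "_ \<Rightarrow> complex"
    using ws by (simp add: o_def sum_list_distinct_conv_sum_set)
  have fin: "finite (B S)" using finite_sub_basis[OF finS] .
  have kraus: "kraus_channel (B S) {..<D} (map R ws)"
    unfolding kraus_channel_def
  proof (intro conjI ballI)
    fix K assume "K \<in> set (map R ws)"
    then show "\<forall>s a. (s \<notin> {..<D} \<or> a \<notin> B S) \<longrightarrow> K s a = 0" by (auto simp: R_def)
  next
    fix a b assume ab: "a \<in> B S" "b \<in> B S"
    have "(\<Sum>K\<leftarrow>map R ws. \<Sum>s<D. cnj (K s a) * K s b)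
        = (\<Sum>s<D. \<Sum>w\<in>B S. cnj (R w s a) * R w s b)"
      unfolding sum_R by (rule sum.swap)
    also have "\<dots> = (\<Sum>s<D. \<Sum>w\<in>B S. of_bool (dec a = s \<and> a = b \<and> a = shift D V s w))"
      using ab by (intro sum.cong) (auto simp: R_def)
    \<comment> \<open>For each \<open>s\<close> the shift permutes the labels \<open>w\<close>, so
      the sum over \<open>w\<close> may be taken over shifted labels.\<close>
    also have "\<dots> = (\<Sum>s<D. \<Sum>w\<in>B S. of_bool (dec a = s \<and> a = b \<and> a = w))"
      by (intro sum.cong refl sum.reindex_bij_betw[OF bij])
    also have "\<dots> = (\<Sum>s<D. if s = dec a then of_bool (a = b) else 0)"
      using ab fin by (intro sum.cong refl) (auto simp: of_bool_def)
    also have "\<dots> = (if a = b then 1 else 0)"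
      using D_pos by (simp add: dec_def)
    finally show "(\<Sum>K\<leftarrow>map R ws. \<Sum>s<D. cnj (K s a) * K s b) = (if a = b then 1 else 0)" .
  qed
  have "apply_channel (B S) (map R ws) (ptrace n (\<lambda>_. D) S (apply_channel {..<D} encoder \<rho>)) t t' = \<rho> t t'"
    if \<rho>: "is_density {..<D} \<rho>" for \<rho> t t'
  proof (cases "t < D \<and> t' < D")
    case False
    then have "\<rho> t t' = 0" using \<rho> by (auto simp: is_density_def)
    moreover have "(\<forall>w a. R w t a = 0) \<or> (\<forall>w b. R w t' b = 0)"
      using False by (auto simp: R_def)
    ultimately show ?thesis unfolding apply_channel_def[of "B S"] sum_R by auto
  next
    case True
    then have t: "t < D" and t': "t' < D" by auto
    let ?M = "ptrace n (\<lambda>_. D) S (apply_channel {..<D} encoder \<rho>)"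
    have in_B: "shift D V s w \<in> B S" if "w \<in> B S" for s w
      using bij that by (auto simp: bij_betw_def)
    have "apply_channel (B S) (map R ws) ?M t t'
        = (\<Sum>w\<in>B S. \<Sum>a\<in>B S. \<Sum>b\<in>B S. R w t a * ?M a b * cnj (R w t' b))"
      unfolding apply_channel_def sum_R ..
    also have "\<dots> = (\<Sum>w\<in>B S. \<Sum>a\<in>B S. \<Sum>b\<in>B S. if b = shift D V t' w then
        (if a = shift D V t w then of_bool (dec a = t \<and> dec b = t') * ?M a b else 0) else 0)"
      using t t' by (intro sum.cong refl) (auto simp: R_def)
    also have "\<dots> = (\<Sum>w\<in>B S. of_bool (dec (shift D V t w) = t \<and> dec (shift D V t' w) = t')
        * ?M (shift D V t w) (shift D V t' w))"
      using in_B fin by (intro sum.cong refl) (simp cong: if_cong)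
    also have "\<dots> = (\<Sum>w\<in>B S. \<Sum>z\<in>B ({..n} - S).
        of_bool (codeword 0 (merge_idx S w z)) * (\<rho> t t' / of_nat code_size))"
    proof (rule sum.cong[OF refl])
      fix w assume w: "w \<in> B S"
      let ?a = "shift D V t w" and ?b = "shift D V t' w"
      have dec: "dec a = s" if "codeword s (merge_idx S a z)" for a s z
      proof -
        have "(\<Sum>i\<in>c. merge_idx S a z i) = (\<Sum>i\<in>c. a i)"
          using c by (intro sum.cong) (auto simp: merge_idx_def)
        then show ?thesis using that c by (auto simp: codeword_def dec_def)
      qed
      have cw: "codeword s (merge_idx S (shift D V s w) z) \<longleftrightarrow> codeword 0 (merge_idx S w z)" if "s < D" for s z
        using codeword_shift[OF that V(2)] shift_merge_left[OF V(1)] by metis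
      \<comment> \<open>As \<open>c\<close> lies inside \<open>S\<close>, \<open>dec\<close> reads
        the secret of any codeword, so only \<open>s = t\<close> and \<open>s' = t'\<close> survive.
        Undoing the two shifts leaves the same condition on \<open>w\<close> and \<open>z\<close>,
        whatever \<open>t\<close> and \<open>t'\<close> are.\<close>
      have iff: "(dec ?a = t \<and> dec ?b = t') \<and> codeword s (merge_idx S ?a z) \<and> codeword s' (merge_idx S ?b z)
          \<longleftrightarrow> s = t \<and> s' = t' \<and> codeword 0 (merge_idx S w z)" for s s' z
        using dec cw[OF t] cw[OF t'] by metis
      have "of_bool (dec ?a = t \<and> dec ?b = t') * ?M ?a ?b = (\<Sum>z\<in>B ({..n} - S). \<Sum>s<D. \<Sum>s'<D.
          of_bool ((dec ?a = t \<and> dec ?b = t') \<and> codeword s (merge_idx S ?a z) \<and> codeword s' (merge_idx S ?b z))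
            * \<rho> s s' / of_nat code_size)"
        unfolding ptrace_encoder[OF S in_B[OF w] in_B[OF w]] sum_distrib_left
        by (simp add: of_bool_conj mult.assoc)
      also have "\<dots> = (\<Sum>z\<in>B ({..n} - S). \<Sum>s<D. \<Sum>s'<D. if s' = t' then (if s = t then
          of_bool (codeword 0 (merge_idx S w z)) * (\<rho> t t' / of_nat code_size) else 0) else 0)"
        unfolding iff by (intro sum.cong refl) auto
      also have "\<dots> = (\<Sum>z\<in>B ({..n} - S). of_bool (codeword 0 (merge_idx S w z)) * (\<rho> t t' / of_nat code_size))"
        using t t' by simp
      finally show "of_bool (dec ?a = t \<and> dec ?b = t') * ?M ?a ?b
        = (\<Sum>z\<in>B ({..n} - S). of_bool (codeword 0 (merge_idx S w z)) * (\<rho> t t' / of_nat code_size))" .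
    qed
    \<comment> \<open>\<open>w\<close> and \<open>z\<close> are the two parts of a full vector, so
      the sum counts the codewords of 0 and cancels \<open>code_size\<close>.\<close>
    also have "\<dots> = (\<Sum>x\<in>B {..n}. of_bool (codeword 0 x) * (\<rho> t t' / of_nat code_size))"
      using S by (intro sum_sub_basis_merge) auto
    also have "\<dots> = \<rho> t t'"
      unfolding sum_distrib_right[symmetric] sum_codeword[OF D_pos] using code_size_pos by simp
    finally show ?thesis .
  qed
  then show ?thesis using kraus unfolding recovers_def by blast
qed

end

section \<open>Absence of information excludes recovery\<close>

lemma is_density_basis_state:
  assumes "finite I" "k \<in> I"
  shows "is_density I (\<lambda>x y. of_bool (x = k \<and> y = k))"
proof -
  have "(\<Sum>x\<in>I. \<Sum>y\<in>I. cnj (v x) * of_bool (x = k \<and> y = k) * v y) = cnj (v k) * v k" for v :: "'a \<Rightarrow> complex"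
  proof -
    have "(\<Sum>x\<in>I. \<Sum>y\<in>I. cnj (v x) * of_bool (x = k \<and> y = k) * v y)
        = (\<Sum>x\<in>I. if x = k then (\<Sum>y\<in>I. if y = k then cnj (v x) * v y else 0) else 0)"
      by (intro sum.cong refl) (auto intro!: sum.cong sum.neutral)
    then show ?thesis using assms by simp
  qed
  moreover have "(\<Sum>x\<in>I. of_bool (x = k \<and> x = k) :: complex) = 1"
    using assms by (simp add: of_bool_def)
  ultimately show ?thesis using assms by (auto simp: is_density_def)
qed

text \<open>Since \<open>2 \<le> D\<close>, the basis states 0 and 1 exist and differ; from equal
  reduced states one decoder would have to return both.\<close>

lemma no_info_imp_not_recovers:
  assumes "2 \<le> D" "no_info D n d Enc S"
  shows "\<not> recovers D n d Enc S"
proof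
  assume "recovers D n d Enc S"
  then obtain Rs where Rs: "\<And>\<rho>. is_density {..<D} \<rho> \<Longrightarrow>
      apply_channel (sub_basis d S) Rs (ptrace n d S (apply_channel {..<D} Enc \<rho>)) = \<rho>"
    by (auto simp: recovers_def)
  let ?\<rho> = "\<lambda>k x y :: nat. of_bool (x = k \<and> y = k) :: complex"
  have \<rho>: "is_density {..<D} (?\<rho> 0)" "is_density {..<D} (?\<rho> 1)"
    using assms(1) is_density_basis_state[of "{..<D}"] by auto
  then have same: "ptrace n d S (apply_channel {..<D} Enc (?\<rho> 0)) = ptrace n d S (apply_channel {..<D} Enc (?\<rho> 1))"
    using assms(2) unfolding no_info_def by blast
  have "?\<rho> 0 = ?\<rho> 1"
    using Rs[OF \<rho>(1)] Rs[OF \<rho>(2)] unfolding same by (rule trans[OF sym])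
  from fun_cong[OF fun_cong[OF this, of 0], of 0] have "?\<rho> 0 0 0 = ?\<rho> 1 0 0" .
  then show False by simp
qed

section \<open>Partial link classifications\<close>

lemma partial_link_classification_exists:
  assumes "finite \<Gamma>" "\<forall>\<alpha>\<in>\<Gamma>. \<alpha> \<noteq> {}"
  shows "\<exists>C. partial_link_classification \<Gamma> C \<and> finite C"
proof -
  define linked where "linked C \<longleftrightarrow> partition_on \<Gamma> C \<and> (\<forall>c\<in>C. \<forall>\<alpha>\<in>c. \<forall>\<beta>\<in>c. \<alpha> \<inter> \<beta> \<noteq> {})" for C
  \<comment> \<open>Singleton classes qualify because no authorized set is empty.\<close>
  have "linked ((\<lambda>\<alpha>. {\<alpha>}) ` \<Gamma>)"
    using assms(2) by (auto simp: linked_def partition_on_def disjoint_def)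
  \<comment> \<open>Take the fewest pairwise intersecting classes. Two classes without a disjoint
    pair across them could be merged, so the second condition of a classification follows from
    minimality.\<close>
  then obtain C where C: "linked C" and min: "\<And>C'. linked C' \<Longrightarrow> card C \<le> card C'"
    using ex_has_least_nat[of linked _ card] by blast
  have fin: "finite C"
    using C assms(1) finite_elements by (auto simp: linked_def)
  have "\<exists>\<alpha>\<in>c1. \<exists>\<beta>\<in>c2. \<alpha> \<inter> \<beta> = {}" if c: "c1 \<in> C" "c2 \<in> C" "c1 \<noteq> c2" for c1 c2
  proof (rule ccontr)
    assume inter: "\<not> ?thesis"
    let ?C' = "insert (c1 \<union> c2) (C - {c1, c2})"
    have C_disjnt: "\<And>c c'. c \<in> C \<Longrightarrow> c' \<in> C \<Longrightarrow> c \<noteq> c' \<Longrightarrow> disjnt c c'"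
      and C_Union: "\<Union>C = \<Gamma>" and C_nonempty: "{} \<notin> C"
      and same: "\<And>c \<alpha> \<beta>. c \<in> C \<Longrightarrow> \<alpha> \<in> c \<Longrightarrow> \<beta> \<in> c \<Longrightarrow> \<alpha> \<inter> \<beta> \<noteq> {}"
      using C by (auto simp: linked_def partition_on_def pairwise_def)
    have cases: "p = c1 \<union> c2 \<or> p \<in> C \<and> p \<noteq> c1 \<and> p \<noteq> c2" if "p \<in> ?C'" for p
      using that by blast
    have "partition_on \<Gamma> ?C'"
    proof (rule partition_onI)
      show "\<Union> ?C' = \<Gamma>" using C_Union c by blast
      show "{} \<notin> ?C'" using C_nonempty c by blast
      show "disjnt p q" if "p \<in> ?C'" "q \<in> ?C'" "p \<noteq> q" for p q
        using cases[OF that(1)] cases[OF that(2)]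
      proof (elim disjE conjE)
        assume "p = c1 \<union> c2" "q \<in> C" "q \<noteq> c1" "q \<noteq> c2"
        then show ?thesis using C_disjnt[of c1 q] C_disjnt[of c2 q] c by (simp add: disjnt_Un1)
      next
        assume "q = c1 \<union> c2" "p \<in> C" "p \<noteq> c1" "p \<noteq> c2"
        then show ?thesis using C_disjnt[of p c1] C_disjnt[of p c2] c by (simp add: disjnt_Un2)
      qed (use that C_disjnt in simp_all)
    qed
    moreover have "\<alpha> \<inter> \<beta> \<noteq> {}" if "p \<in> ?C'" "\<alpha> \<in> p" "\<beta> \<in> p" for p \<alpha> \<beta>
    proof -
      have "\<alpha> \<inter> \<beta> \<noteq> {}" if "\<alpha> \<in> c1" "\<beta> \<in> c2" for \<alpha> \<beta> using inter that by blast
      then have "\<alpha> \<inter> \<beta> \<noteq> {}" if "\<alpha> \<in> c1 \<union> c2" "\<beta> \<in> c1 \<union> c2"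
        using that same[OF c(1), of \<alpha> \<beta>] same[OF c(2), of \<alpha> \<beta>] Int_commute[of \<alpha> \<beta>] by blast
      then show ?thesis using cases[OF that(1)] same[of p \<alpha> \<beta>] that(2,3) by blast
    qed
    ultimately have "linked ?C'" unfolding linked_def by blast
    then have "card C \<le> card ?C'" by (rule min)
    also have "\<dots> \<le> Suc (card (C - {c1, c2}))" by (rule card_insert_le_m1) simp_all
    also have "\<dots> < card C"
    proof -
      have "card {c1, c2} \<le> card C" using c fin by (intro card_mono) auto
      then show ?thesis using c fin by (simp add: card_Diff_subset)
    qed
    finally show False by simp
  qed
  then have "partial_link_classification \<Gamma> C"
    using C by (auto simp: linked_def partial_link_classification_def)
  then show ?thesis using fin by blast
qed

text \<open>The minimum is attained because some finite classification exists; with at most one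
  class, all authorized sets lie in it.\<close>

lemma plc_min_le_1_imp_intersecting:
  assumes "finite \<Gamma>" "\<forall>\<alpha>\<in>\<Gamma>. \<alpha> \<noteq> {}" "plc_min \<Gamma> \<le> 1" "\<alpha> \<in> \<Gamma>" "\<beta> \<in> \<Gamma>"
  shows "\<alpha> \<inter> \<beta> \<noteq> {}"
proof -
  have "\<exists>k C. partial_link_classification \<Gamma> C \<and> finite C \<and> card C = k"
    using partial_link_classification_exists[OF assms(1,2)] by blast
  then obtain C where C: "partial_link_classification \<Gamma> C" "finite C" "card C = plc_min \<Gamma>"
    using LeastI_ex[of "\<lambda>k. \<exists>C. partial_link_classification \<Gamma> C \<and> finite C \<and> card C = k"]
    unfolding plc_min_def by blast
  obtain c where c: "c \<in> C" "\<alpha> \<in> c"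
    using C(1) assms(4) by (auto simp: partial_link_classification_def partition_on_def)
  obtain c' where c': "c' \<in> C" "\<beta> \<in> c'"
    using C(1) assms(5) by (auto simp: partial_link_classification_def partition_on_def)
  have "c = c'"
    using assms(3) C(2,3) c(1) c'(1) card_le_Suc0_iff_eq[of C] by auto
  then show ?thesis using C(1) c c' by (auto simp: partial_link_classification_def)
qed

section \<open>The scheme for a monotone access structure\<close>

lemma AQSS_exists:
  fixes P :: "'p set" and resident :: bool
  assumes "finite P" and "P \<noteq> {}" and "\<Gamma> \<noteq> {}" and auth: "\<forall>\<alpha>\<in>\<Gamma>. \<alpha> \<noteq> {} \<and> \<alpha> \<subseteq> P"
    and "D \<ge> 2" and mono: "monotone_access P \<Gamma>"
    and inter: "\<not> resident \<Longrightarrow> \<forall>\<alpha>\<in>\<Gamma>. \<forall>\<beta>\<in>\<Gamma>. \<alpha> \<inter> \<beta> \<noteq> {}"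
  shows "\<exists>n d Res own Enc. AQSS P \<Gamma> D n d Res own Enc \<and> card Res = of_bool resident"
proof -
  \<comment> \<open>Slot \<open>f (X, i)\<close> with \<open>X \<subseteq> P\<close> belongs to player \<open>i\<close>, slot \<open>m\<close> is the resident share if there is one
    (otherwise a share of \<open>p0\<close> that no check involves), and slot \<open>n = m + 1\<close> is the discarded environment.\<close>
  define Q where "Q = Pow P \<times> P"
  define m where "m = card Q"
  have finQ: "finite Q" using assms(1) by (simp add: Q_def)
  obtain f where f: "bij_betw f Q {..<m}"
    using ex_bij_betw_finite_nat[OF finQ] by (auto simp: m_def atLeast0LessThan)
  have f_inj: "f p = f q \<longleftrightarrow> p = q" if "p \<in> Q" "q \<in> Q" for p q
    using f that by (auto simp: bij_betw_def inj_on_def)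
  have f_less: "f p < m" if "p \<in> Q" for p
    using f that by (auto simp: bij_betw_def)
  obtain p0 where p0: "p0 \<in> P" using assms(2) by blast
  define own where "own j = (if j < m then snd (inv_into Q f j) else p0)" for j
  have own_f: "own (f p) = snd p" if "p \<in> Q" for p
    using that f f_less by (simp add: own_def bij_betw_def)
  have own_P: "own j \<in> P" for j
  proof (cases "j < m")
    case True
    then obtain p where "p \<in> Q" "f p = j"
      using f by (metis bij_betw_imp_surj_on imageE lessThan_iff)
    then show ?thesis using own_f[of p] by (auto simp: Q_def)
  qed (simp add: own_def p0)
  define Res where "Res = (if resident then {m} else {})"
  define n where "n = Suc m"
  define holders where "holders X = (if X \<in> \<Gamma> then X else P - X)" for X
  define check where "check X = (\<lambda>i. f (X, i)) ` holders X \<union> (if X \<in> \<Gamma> then Res else {n})" for X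
  define C where "C = check ` Pow P"
  have holders_sub: "holders X \<subseteq> P" if "X \<subseteq> P" for X
    using that by (auto simp: holders_def)
  have inQ: "(X, i) \<in> Q" if "X \<subseteq> P" "i \<in> P" for X i using that by (simp add: Q_def)
  \<comment> \<open>The shares of \<open>P\<close> later supply the \<open>V\<close> that
    \<open>checks_hit\<close> asks for.\<close>
  have P_auth: "P \<in> \<Gamma>" using assms(3) auth mono by (auto simp: monotone_access_def)
  have share_iff: "j \<in> shares_of n Res own A \<longleftrightarrow> j \<in> Res \<or> j < n \<and> own j \<in> A" for j A
    by (auto simp: shares_of_def Res_def n_def split: if_splits)
  have Res_share: "Res \<subseteq> shares_of n Res own A" for A by (auto simp: shares_of_def)
  have Res_sub: "Res \<subseteq> {..<n}" by (auto simp: Res_def n_def)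
  then have shares_sub: "shares_of n Res own A \<subseteq> {..<n}" for A by (auto simp: shares_of_def)
  have f_share: "f (X, i) \<in> shares_of n Res own A \<longleftrightarrow> i \<in> A" if "X \<subseteq> P" "i \<in> P" for X i A
    unfolding share_iff using f_less[OF inQ[OF that]] own_f[OF inQ[OF that]]
    by (auto simp: Res_def n_def)
  have slots_less: "(\<lambda>i. f (X, i)) ` holders X \<subseteq> {..<m}" if "X \<subseteq> P" for X
    using f_less inQ that holders_sub[OF that] by blast
  \<comment> \<open>Slots of different \<open>X\<close> are distinct, so a choice \<open>t\<close>
    of one slot per member of \<open>F\<close> meets the slots of \<open>X\<close> at most in the
    one chosen for \<open>X\<close>.\<close>
  have slots_Int: "(\<lambda>i. f (X, i)) ` holders X \<inter> (\<lambda>Y. f (Y, t Y)) ` F = (if X \<in> F then {f (X, t X)} else {})"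
    if X: "X \<subseteq> P" and t: "\<And>Y. Y \<in> F \<Longrightarrow> Y \<subseteq> P \<and> t Y \<in> holders Y" for X F t
  proof -
    have "f (X, i) = f (Y, t Y) \<longleftrightarrow> X = Y \<and> i = t Y" if "i \<in> holders X" "Y \<in> F" for i Y
      using that X t[OF that(2)] f_inj[of "(X, i)" "(Y, t Y)"]
        holders_sub inQ by blast
    then show ?thesis using t by auto
  qed
  have hit_auth: "\<exists>V\<subseteq>shares_of n Res own A. \<forall>c\<in>C. card (c \<inter> V) = 1" if A: "A \<in> \<Gamma>" for A
  proof -
    have AP: "A \<subseteq> P" using A auth by blast
    have "\<exists>i. i \<in> holders X \<and> i \<in> A" if "X \<subseteq> P" "X \<notin> \<Gamma> \<or> \<not> resident" for X
    proof (cases "X \<in> \<Gamma>")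
      case True
      then have "X \<inter> A \<noteq> {}" using that inter A by blast
      then show ?thesis using True by (auto simp: holders_def)
    next
      case False
      then have "\<not> A \<subseteq> X" using mono A that(1) by (auto simp: monotone_access_def)
      then show ?thesis using False AP by (auto simp: holders_def)
    qed
    then obtain t where t: "\<And>X. X \<subseteq> P \<Longrightarrow> X \<notin> \<Gamma> \<or> \<not> resident \<Longrightarrow> t X \<in> holders X \<and> t X \<in> A"
      by metis
    \<comment> \<open>With a resident share, the checks of authorized \<open>X\<close> are already
      hit in slot \<open>m\<close>, and a player slot would be a second hit. Without one,
      \<open>Res\<close> is empty and every \<open>X\<close> needs a player slot.\<close>
    define V where "V = (\<lambda>X. f (X, t X)) ` {X \<in> Pow P. X \<notin> \<Gamma> \<or> \<not> resident} \<union> Res"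
    have "f (X, t X) \<in> shares_of n Res own A" if "X \<subseteq> P" "X \<notin> \<Gamma> \<or> \<not> resident" for X
      using t[OF that] f_share[OF that(1)] AP by blast
    then have "V \<subseteq> shares_of n Res own A"
      using Res_share[of A] unfolding V_def by blast
    moreover have "card (check X \<inter> V) = 1" if X: "X \<subseteq> P" for X
    proof -
      let ?F = "{X \<in> Pow P. X \<notin> \<Gamma> \<or> \<not> resident}"
      let ?S = "(\<lambda>i. f (X, i)) ` holders X" and ?T = "(\<lambda>X. f (X, t X)) ` ?F"
      have ST: "?S \<inter> ?T = (if X \<in> ?F then {f (X, t X)} else {})"
        using t by (intro slots_Int X) auto
      have S_less: "?S \<subseteq> {..<m}" using slots_less[OF X] .
      have T_less: "?T \<subseteq> {..<m}" using t slots_less by blast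
      have "m \<notin> ?S" "m \<notin> ?T" "n \<notin> ?T" using subsetD[OF S_less] subsetD[OF T_less]
        unfolding n_def by (meson lessThan_iff less_irrefl not_less_eq less_SucI)+
      then have "check X \<inter> V = (?S \<inter> ?T) \<union> (if X \<in> \<Gamma> then Res else {})"
        unfolding check_def V_def Res_def n_def by auto
      then have "check X \<inter> V = (if X \<notin> \<Gamma> \<or> \<not> resident then {f (X, t X)} else {m})"
        unfolding ST Res_def using X by auto
      then show ?thesis by simp
    qed
    ultimately show ?thesis unfolding C_def by (intro exI[of _ V]) auto
  qed
  have hit_unauth: "\<exists>V\<subseteq>{..n} - shares_of n Res own A. \<forall>c\<in>C. card (c \<inter> V) = 1"
    if A: "A \<subseteq> P" "A \<notin> \<Gamma>" for A
  proof -
    have "\<exists>i. i \<in> X - A" if "X \<in> \<Gamma>" for X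
      using mono A that unfolding monotone_access_def by blast
    then obtain t where t: "\<And>X. X \<in> \<Gamma> \<Longrightarrow> t X \<in> X - A" by metis
    \<comment> \<open>Slot \<open>n\<close> is never a share and hits exactly the checks of
      unauthorized \<open>X\<close>; those of authorized \<open>X\<close> are hit in the slot of a
      player of \<open>X\<close> missing from \<open>A\<close>.\<close>
    define V where "V = (\<lambda>X. f (X, t X)) ` \<Gamma> \<union> {n}"
    have tq: "Y \<subseteq> P \<and> t Y \<in> holders Y" if "Y \<in> \<Gamma>" for Y
      using t[OF that] auth that by (auto simp: holders_def)
    have T_less: "(\<lambda>X. f (X, t X)) ` \<Gamma> \<subseteq> {..<m}" using tq slots_less by blast
    have "f (X, t X) \<notin> shares_of n Res own A" if "X \<in> \<Gamma>" for X
      using t[OF that] tq[OF that] f_share[of X "t X" A] holders_sub[of X] by blast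
    then have "V \<subseteq> {..n} - shares_of n Res own A"
      using T_less shares_sub[of A] by (auto simp: V_def n_def)
    moreover have "card (check X \<inter> V) = 1" if X: "X \<subseteq> P" for X
    proof -
      have "(\<lambda>i. f (X, i)) ` holders X \<inter> (\<lambda>X. f (X, t X)) ` \<Gamma> = (if X \<in> \<Gamma> then {f (X, t X)} else {})"
        using X tq by (rule slots_Int)
      then have "check X \<inter> V = (if X \<in> \<Gamma> then {f (X, t X)} else {n})"
        using slots_less[OF X] T_less unfolding check_def V_def Res_def n_def by (auto split: if_splits)
      then show ?thesis by simp
    qed
    ultimately show ?thesis unfolding C_def by (intro exI[of _ V]) auto
  qed
  interpret check_code D n C
  proof
    show "0 < D" using assms(5) by simp
    show "C \<noteq> {}" by (auto simp: C_def)
    show "c \<subseteq> {..n}" if c: "c \<in> C" for c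
    proof -
      obtain X where X: "X \<subseteq> P" "c = check X" using c by (auto simp: C_def)
      have "f (X, i) < n" if "i \<in> holders X" for i
        using f_less[OF inQ[OF X(1)]] holders_sub[OF X(1)] that by (auto simp: n_def intro: less_SucI)
      then show ?thesis using X Res_sub by (auto simp: check_def less_imp_le)
    qed
    show "\<exists>V\<subseteq>{..n}. \<forall>c\<in>C. card (c \<inter> V) = 1"
    proof -
      obtain V where "V \<subseteq> shares_of n Res own P" "\<forall>c\<in>C. card (c \<inter> V) = 1"
        using hit_auth[OF P_auth] by blast
      moreover have "shares_of n Res own P \<subseteq> {..n}" using shares_sub[of P] by auto
      ultimately show ?thesis by blast
    qed
  qed
  have rec: "recovers D n (\<lambda>_. D) encoder (shares_of n Res own A)" if A: "A \<in> \<Gamma>" for A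
  proof -
    obtain V where V: "V \<subseteq> shares_of n Res own A" "\<forall>c\<in>C. card (c \<inter> V) = 1"
      using hit_auth[OF A] by blast
    have AP: "A \<subseteq> P" using A auth by blast
    \<comment> \<open>The check of \<open>A\<close> itself is read off: its slots belong to players
      in \<open>A\<close> or are resident.\<close>
    have "check A \<in> C" using AP by (auto simp: C_def)
    moreover have "check A \<subseteq> shares_of n Res own A"
      using A AP f_share[OF AP] Res_share[of A] unfolding check_def holders_def by auto
    ultimately show ?thesis using recovers_encoder[OF shares_sub _ _ V(1)] V(2) by blast
  qed
  have secret: "no_info D n (\<lambda>_. D) encoder (shares_of n Res own A)" if A: "A \<subseteq> P" "A \<notin> \<Gamma>" for A
  proof -
    obtain V where V: "V \<subseteq> {..n} - shares_of n Res own A" "\<forall>c\<in>C. card (c \<inter> V) = 1"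
      using hit_unauth[OF A] by blast
    \<comment> \<open>Now the check of \<open>A\<close> consists of slots of players outside
      \<open>A\<close> and the environment.\<close>
    have "check A \<in> C" using A by (auto simp: C_def)
    moreover have "check A \<inter> shares_of n Res own A = {}"
      using A f_share[OF A(1)] shares_sub[of A] by (auto simp: check_def holders_def)
    ultimately show ?thesis using no_info_encoder[OF shares_sub _ _ V(1)] V(2) by blast
  qed
  have rec_iff: "A \<in> \<Gamma> \<longleftrightarrow> recovers D n (\<lambda>_. D) encoder (shares_of n Res own A)" if "A \<subseteq> P" for A
    using rec no_info_imp_not_recovers[OF assms(5) secret[OF that]] by blast
  have auth_iff: "(\<exists>\<alpha>\<in>\<Gamma>. \<alpha> \<subseteq> A) \<longleftrightarrow> A \<in> \<Gamma>" if "A \<subseteq> P" for A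
    using mono that by (auto simp: monotone_access_def)
  \<comment> \<open>If slot \<open>m\<close> is resident, \<open>card Res < n\<close> requires
    another slot besides it.\<close>
  have "m > 0" using p0 finQ by (auto simp: m_def card_gt_0_iff Q_def)
  then have "card Res < n" by (simp add: Res_def n_def)
  then have "AQSS P \<Gamma> D n (\<lambda>_. D) Res own encoder"
    unfolding AQSS_def
    using Res_sub own_P kraus_channel_encoder rec secret auth_iff rec_iff assms(5) by simp
  then show ?thesis by (intro exI conjI) (auto simp: Res_def)
qed

text \<open>Two clauses of \<open>AQSS\<close> combine: every set of players containing an
  authorized set recovers, and a recovering set is a member of \<Gamma>.\<close>

lemma AQSS_imp_monotone_access: "AQSS P \<Gamma> D n d Res own Enc \<Longrightarrow> monotone_access P \<Gamma>"
  unfolding AQSS_def monotone_access_def by blast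

theorem mainTheorem1:
  fixes P :: "'p set" and \<Gamma> :: "'p set set" and D :: nat
  assumes "finite P" and "P \<noteq> {}"
    and "\<Gamma> \<noteq> {}" and "\<forall>\<alpha>\<in>\<Gamma>. \<alpha> \<noteq> {} \<and> \<alpha> \<subseteq> P"
    and "D \<ge> 2"
  shows "((\<exists>n d Res own Enc. AQSS P \<Gamma> D n d Res own Enc) \<longleftrightarrow> monotone_access P \<Gamma>) \<and>
         (monotone_access P \<Gamma> \<longrightarrow>
            (\<exists>n d Res own Enc. AQSS P \<Gamma> D n d Res own Enc \<and> card Res \<le> plc_min \<Gamma> - 1))"
proof -
  have "\<exists>n d Res own Enc. AQSS P \<Gamma> D n d Res own Enc \<and> card Res \<le> plc_min \<Gamma> - 1"
    if mono: "monotone_access P \<Gamma>"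
  proof -
    have "finite \<Gamma>" using assms(1,4) finite_subset[of \<Gamma> "Pow P"] by blast
    then have "\<not> 2 \<le> plc_min \<Gamma> \<Longrightarrow> \<forall>\<alpha>\<in>\<Gamma>. \<forall>\<beta>\<in>\<Gamma>. \<alpha> \<inter> \<beta> \<noteq> {}"
      using plc_min_le_1_imp_intersecting[of \<Gamma>] assms(4) by simp
    then obtain n d Res own Enc where
      "AQSS P \<Gamma> D n d Res own Enc" "card Res = of_bool (2 \<le> plc_min \<Gamma>)"
      using AQSS_exists[OF assms mono, of "2 \<le> plc_min \<Gamma>"] by blast
    \<comment> \<open>For \<open>plc_min \<Gamma> \<le> 1\<close> the truncated difference is 0 and
      no resident share is used; otherwise the bound is at least 1.\<close>
    moreover have "(of_bool (2 \<le> plc_min \<Gamma>) :: nat) \<le> plc_min \<Gamma> - 1" by auto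
    ultimately show ?thesis by metis
  qed
  then show ?thesis using AQSS_imp_monotone_access by blast
qed

end
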